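(* For every infinite cardinal $\kappa$, the field $\mathbb{C}_\kappa$ of $\kappa$-complex numbers contains non-zero infinitesimals in the sense that $\mathbb{C}_\kappa$ contains a non-Archimedean subfield, that is, a subfield which, equipped with a suitable total order compatible with the field operations, is a non-Archimedean totally ordered field.
   Context: The set-theoretical framework is ZFC together with the Generalized Continuum Hypothesis, $2^\kappa=\kappa_+$ for all infinite cardinals $\kappa$, where $\kappa_+$ denotes the successor cardinal of $\kappa$. For an infinite cardinal $\kappa$, $\mathbb{C}_\kappa$ denotes an algebraically closed field of characteristic zero and cardinality $\kappa_+$ (unique up to isomorphism); its elements are called $\kappa$-complex numbers. In a totally ordered field $\mathbb{K}$ put $|x|=\max\{-x,x\}$; an element $x\in\mathbb{K}$ is infinitesimal if $|x|<1/n$ for all $n\in\mathbb{N}=\{1,2,3,\dots\}$. A totally ordered field is non-Archimedean if it contains a non-zero infinitesimal. *)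

theory Defs
  imports "HOL-Computational_Algebra.Polynomial"
begin

unbundle cardinal_syntax

text \<open>
  Cardinals are the cardinal orders of the library: a relation \<open>r\<close> with \<open>Card_order r\<close>.
  \<open>GCH TYPE('k)\<close> is the Generalized Continuum Hypothesis for the infinite cardinals represented
  on the type \<open>'k\<close>; HOL has no quantification over types, so the hypothesis can only be stated
  one type at a time.
\<close>

definition GCH :: "'k itself \<Rightarrow> bool" where
  "GCH _ \<longleftrightarrow> (\<forall>r :: 'k rel. Cinfinite r \<longrightarrow> ctwo ^c r =o cardSuc r)"

definition is_subfield :: "'a::field set \<Rightarrow> bool" where
  "is_subfield K \<longleftrightarrow>
     0 \<in> K \<and> 1 \<in> K \<and>
     (\<forall>x\<in>K. \<forall>y\<in>K. x + y \<in> K) \<and>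
     (\<forall>x\<in>K. - x \<in> K) \<and>
     (\<forall>x\<in>K. \<forall>y\<in>K. x * y \<in> K) \<and>
     (\<forall>x\<in>K. x \<noteq> 0 \<longrightarrow> inverse x \<in> K)"

text \<open>An order is a relation on \<open>K\<close>, with \<open>(x, y) \<in> le\<close> read as \<open>x \<le> y\<close>.\<close>

definition totally_ordered_subfield :: "'a::field set \<Rightarrow> 'a rel \<Rightarrow> bool" where
  "totally_ordered_subfield K le \<longleftrightarrow>
     is_subfield K \<and>
     linear_order_on K le \<and>
     (\<forall>x\<in>K. \<forall>y\<in>K. \<forall>z\<in>K. (x, y) \<in> le \<longrightarrow> (x + z, y + z) \<in> le) \<and>
     (\<forall>x\<in>K. \<forall>y\<in>K. (0, x) \<in> le \<longrightarrow> (0, y) \<in> le \<longrightarrow> (0, x * y) \<in> le)"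

text \<open>\<open>max {- x, x}\<close> with respect to the given order.\<close>

definition order_abs :: "'a::field rel \<Rightarrow> 'a \<Rightarrow> 'a" where
  "order_abs le x = (if (- x, x) \<in> le then x else - x)"

definition infinitesimal_in :: "'a::field set \<Rightarrow> 'a rel \<Rightarrow> 'a \<Rightarrow> bool" where
  "infinitesimal_in K le x \<longleftrightarrow>
     x \<in> K \<and> (\<forall>n::nat. n \<ge> 1 \<longrightarrow> (order_abs le x, 1 / of_nat n) \<in> le - Id)"

definition non_Archimedean :: "'a::field set \<Rightarrow> 'a rel \<Rightarrow> bool" where
  "non_Archimedean K le \<longleftrightarrow> (\<exists>x. x \<noteq> 0 \<and> infinitesimal_in K le x)"

end

theory Submission
  imports Defs "HOL-Computational_Algebra.Fraction_Field" "HOL-Library.Countable_Set_Type"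
begin

text \<open>
  A field of infinite successor cardinality is uncountable, whereas the algebraic numbers in a
  field of characteristic zero are countable; so the field contains a transcendental element \<open>t\<close>.
  Evaluation at \<open>t\<close> embeds \<open>\<int>[X]\<close>, hence also its fraction field, which is the field of rational
  functions \<open>\<rat>(X)\<close>. Ordering polynomials by the sign of the leading coefficient turns the latter
  into an ordered field in which \<open>X\<close> exceeds every natural number, so \<open>1 / X\<close> is a positive
  infinitesimal. Transporting this order along the embedding makes \<open>\<rat>(t)\<close> a non-Archimedean
  subfield, with \<open>1 / t\<close> as infinitesimal.
\<close>

text \<open>
  There are countably many integer coefficient lists, and each nonzero polynomial has finitely many
  roots.
\<close>

lemma countable_algebraic: "countable {x :: 'a::field_char_0. algebraic x}"
proof (rule countable_subset)
  let ?P = "\<lambda>cs :: int list. Poly (map of_int cs) :: 'a poly"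
  show "countable (\<Union>cs \<in> {cs. ?P cs \<noteq> 0}. {x. poly (?P cs) x = 0})"
    by (rule countable_UN[OF countableI_type]) (auto intro!: countable_finite poly_roots_finite)
  show "{x :: 'a. algebraic x} \<subseteq> (\<Union>cs \<in> {cs. ?P cs \<noteq> 0}. {x. poly (?P cs) x = 0})"
  proof
    fix x :: 'a assume "x \<in> {x. algebraic x}"
    then obtain p where p: "\<And>i. coeff p i \<in> \<int>" "p \<noteq> 0" "poly p x = 0"
      by (metis algebraicE mem_Collect_eq)
    have "set (coeffs p) \<subseteq> range of_int"
      using p(1) by (auto simp: coeffs_def Ints_def)
    then obtain cs where "coeffs p = map of_int cs"
      by (metis ex_map_conv subsetD imageE)
    then have "?P cs = p"
      by (metis Poly_coeffs)
    with p show "x \<in> (\<Union>cs \<in> {cs. ?P cs \<noteq> 0}. {x. poly (?P cs) x = 0})"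
      by blast
  qed
qed

lemma uncountable_if_card_cardSuc:
  assumes "Cinfinite r" and "|A| =o cardSuc r"
  shows "\<not> countable A"
proof
  assume "countable A"
  then have "cardSuc r \<le>o natLeq"
    using assms(2) by (metis countable_card_le_natLeq ordIso_ordLeq_trans ordIso_symmetric)
  also have "natLeq \<le>o r"
    using assms(1) by (simp add: natLeq_ordLeq_cinfinite)
  finally show False
    using assms(1) cardSuc_greater not_ordLess_ordLeq by blast
qed

definition eval_int_poly :: "'a::comm_ring_1 \<Rightarrow> int poly \<Rightarrow> 'a" where
  "eval_int_poly t p = poly (map_poly of_int p) t"

lemma eval_int_poly_0 [simp]: "eval_int_poly t 0 = 0"
  and eval_int_poly_1 [simp]: "eval_int_poly t 1 = 1"
  and eval_int_poly_pCons [simp]: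
    "eval_int_poly t (pCons a p) = of_int a + t * eval_int_poly t p"
  by (simp_all add: eval_int_poly_def map_poly_pCons)

lemma eval_int_poly_add [simp]:
  "eval_int_poly t (p + q) = eval_int_poly t p + eval_int_poly t q"
  by (induction p q rule: poly_induct2) (simp_all add: algebra_simps)

lemma eval_int_poly_smult [simp]:
  "eval_int_poly t (smult c p) = of_int c * eval_int_poly t p"
  by (induction p) (simp_all add: algebra_simps)

lemma eval_int_poly_mult [simp]:
  "eval_int_poly t (p * q) = eval_int_poly t p * eval_int_poly t q"
  by (induction p) (simp_all add: algebra_simps)

text \<open>
  Transcendence of \<open>t\<close> is exactly what makes evaluation at \<open>t\<close> injective, so that it extends
  to fractions.
\<close>

lemma eval_int_poly_eq_0_iff:
  fixes t :: "'a::field_char_0"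
  assumes "\<not> algebraic t"
  shows "eval_int_poly t p = 0 \<longleftrightarrow> p = 0"
proof
  assume "eval_int_poly t p = 0"
  then have "map_poly of_int p = (0 :: 'a poly)"
    using assms algebraicI[of "map_poly of_int p" t]
    by (auto simp: eval_int_poly_def coeff_map_poly)
  then show "p = 0"
    by (simp add: map_poly_eq_0_iff)
qed simp

text \<open>
  The universal property of the fraction field: the value \<open>g a / g b\<close> does not depend on the
  representative of \<open>Fract a b\<close>, and injectivity of \<open>g\<close> keeps the denominators nonzero.
\<close>

lemma fraction_field_extension:
  fixes g :: "'b::idom \<Rightarrow> 'a::field"
  assumes add: "\<And>a b. g (a + b) = g a + g b"
    and mult: "\<And>a b. g (a * b) = g a * g b"
    and one: "g 1 = 1"
    and nonzero: "\<And>a. g a = 0 \<longleftrightarrow> a = 0"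
  obtains f :: "'b fract \<Rightarrow> 'a" where
    "\<And>x y. f (x + y) = f x + f y" "\<And>x y. f (x * y) = f x * f y" "f 1 = 1"
proof
  define f where "f q = (THE w. \<exists>a b. b \<noteq> 0 \<and> q = Fract a b \<and> w = g a / g b)" for q
  have f_Fract: "f (Fract a b) = g a / g b" if "b \<noteq> 0" for a b
    unfolding f_def
  proof (rule the_equality)
    fix w assume "\<exists>c d. d \<noteq> 0 \<and> Fract a b = Fract c d \<and> w = g c / g d"
    then obtain c d where cd: "d \<noteq> 0" "Fract a b = Fract c d" "w = g c / g d"
      by blast
    then have "g (a * d) = g (c * b)"
      using that by (simp add: eq_fract)
    then show "w = g a / g b"
      using that cd nonzero by (simp add: mult frac_eq_eq)
  qed (use that in blast)
  show "f (x + y) = f x + f y" for x y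
    by (cases x; cases y) (simp add: f_Fract add mult nonzero add_frac_eq)
  show "f (x * y) = f x * f y" for x y
    by (cases x; cases y) (simp add: f_Fract mult)
  show "f 1 = 1"
    by (simp add: One_fract_def f_Fract one)
qed

text \<open>
  A field homomorphism is injective, so the order of \<open>'b\<close> can be pushed forward to its range. It
  sends each \<open>1 / n\<close> to \<open>1 / n\<close>, so the image of a nonzero infinitesimal \<open>e\<close> is again infinitesimal.
\<close>

lemma ordered_subfield_range:
  fixes f :: "'b::linordered_field \<Rightarrow> 'a::field" and e :: 'b
  assumes add: "\<And>x y. f (x + y) = f x + f y"
    and mult: "\<And>x y. f (x * y) = f x * f y"
    and one: "f 1 = 1"
  defines "le \<equiv> {(f x, f y) | x y. x \<le> y}"
  shows "totally_ordered_subfield (range f) le"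
    and "\<lbrakk>e \<noteq> 0; \<And>n::nat. n \<ge> 1 \<Longrightarrow> \<bar>e\<bar> < 1 / of_nat n\<rbrakk> \<Longrightarrow> non_Archimedean (range f) le"
proof -
  have zero: "f 0 = 0"
    by (metis add add_0 add_cancel_left_right)
  have neg: "f (- x) = - f x" for x
    using add[of x "- x"] by (simp add: zero add_eq_0_iff)
  have inv: "f (inverse x) = inverse (f x)" for x
  proof (cases "x = 0")
    case False
    then show ?thesis
      using mult[of x "inverse x"] by (simp add: one inverse_unique)
  qed (simp add: zero)
  have eq_iff: "f x = f y \<longleftrightarrow> x = y" for x y
  proof
    assume "f x = f y"
    then have "f (x - y) = 0"
      using add[of x "- y"] by (simp add: neg)
    then have "f ((x - y) * inverse (x - y)) = 0"
      by (simp only: mult mult_zero_left)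
    then show "x = y"
      by (metis one right_inverse zero_neq_one right_minus_eq)
  qed simp
  have le_iff: "(f x, f y) \<in> le \<longleftrightarrow> x \<le> y" for x y
    by (auto simp: le_def eq_iff)
  have pos_iff: "(0, f y) \<in> le \<longleftrightarrow> 0 \<le> y" for y
    using le_iff[of 0 y] by (simp add: zero)
  have "is_subfield (range f)"
    unfolding is_subfield_def
    by (auto simp flip: add mult neg inv) (metis zero rangeI, metis one rangeI)
  moreover have "linear_order_on (range f) le"
    unfolding order_on_defs refl_on_def trans_def antisym_def total_on_def
    by (auto simp: le_def eq_iff) 
  ultimately show "totally_ordered_subfield (range f) le"
    unfolding totally_ordered_subfield_def
    by (auto simp: le_iff pos_iff simp flip: add mult)

  assume "e \<noteq> 0" and small: "\<And>n::nat. n \<ge> 1 \<Longrightarrow> \<bar>e\<bar> < 1 / of_nat n"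
  have of_nat: "f (of_nat n) = of_nat n" for n
    by (induction n) (simp_all add: zero one add)
  have "order_abs le (f e) = f \<bar>e\<bar>"
    using le_iff[of "- e" e] by (auto simp: order_abs_def neg abs_if)
  moreover have "f (1 / of_nat n) = 1 / of_nat n" for n
    by (simp add: divide_inverse mult one inv of_nat)
  ultimately have "(order_abs le (f e), 1 / of_nat n) \<in> le - Id" if "n \<ge> 1" for n
    using small[OF that] le_iff[of "\<bar>e\<bar>" "1 / of_nat n"] eq_iff[of "\<bar>e\<bar>" "1 / of_nat n"] by auto
  then show "non_Archimedean (range f) le"
    unfolding non_Archimedean_def infinitesimal_in_def
    using \<open>e \<noteq> 0\<close> eq_iff[of e 0] zero by (intro exI[of _ "f e"]) auto
qed

text \<open>
  The order on polynomials is decided by leading coefficients, so \<open>X - n\<close> is positive for every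
  natural number \<open>n\<close>.
\<close>

lemma fract_poly_infinitesimal:
  fixes n :: nat
  assumes "n \<ge> 1"
  shows "\<bar>Fract 1 [:0, 1:] :: int poly fract\<bar> < 1 / of_nat n"
proof -
  define X N :: "int poly" where "X = [:0, 1:]" and "N = of_nat n"
  have "N < X" "0 < N"
    using assms by (simp_all add: X_def N_def less_poly_def of_nat_poly pos_poly_pCons)
  moreover from this have "0 < X"
    by (rule less_trans[rotated])
  ultimately have "N * (X * N) < X * (X * N)"
    by (intro mult_strict_right_mono mult_pos_pos)
  with \<open>0 < X\<close> \<open>0 < N\<close> have "\<bar>Fract 1 X\<bar> < Fract 1 N"
    by (subst abs_fract, subst less_fract) auto
  then show ?thesis
    by (simp add: X_def N_def of_nat_fract One_fract_def)
qed

theorem theorem8p4: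
  fixes \<kappa> :: "'k rel"
  assumes GCH_k: "GCH TYPE('k)"
    and GCH_C: "GCH TYPE('c)"
    and infinite_cardinal: "Cinfinite \<kappa>"
    and card_C: "|UNIV :: 'c::{alg_closed_field, field_char_0} set| =o cardSuc \<kappa>"
  shows "\<exists>(K :: 'c set) le. totally_ordered_subfield K le \<and> non_Archimedean K le"
proof -
  have "{x :: 'c. algebraic x} \<noteq> UNIV"
    using countable_algebraic[where 'a = 'c] uncountable_if_card_cardSuc[OF infinite_cardinal card_C]
    by metis
  then obtain t :: 'c where t: "\<not> algebraic t"
    by blast
  obtain f :: "int poly fract \<Rightarrow> 'c" where f:
    "\<And>x y. f (x + y) = f x + f y" "\<And>x y. f (x * y) = f x * f y" "f 1 = 1"
    by (rule fraction_field_extension[of "eval_int_poly t"])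
      (auto simp: eval_int_poly_eq_0_iff[OF t])
  have "Fract 1 [:0, 1:] \<noteq> (0 :: int poly fract)"
    by (simp add: Zero_fract_def eq_fract)
  then show ?thesis
    using ordered_subfield_range[of f, OF f] fract_poly_infinitesimal by blast
qed

end
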